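(* Let $p$ be a prime and let $G$ be a noncyclic $p$-group of nilpotence class $l \ge 1$ and order $p^n$. Then $$\eta(G) \ge (p-1)\left(\frac{n}{l} - 2\right) + p + 1.$$
   Context: For a finite group $G$, a maximal cyclic subgroup of $G$ is a cyclic subgroup of $G$ that is not properly contained in any other cyclic subgroup of $G$ (if $G$ is cyclic, $G$ itself is its only maximal cyclic subgroup). $\eta(G)$ denotes the number of $G$-conjugacy classes of maximal cyclic subgroups of $G$. The lower central series is indexed as $G^1 = G$ and $G^{i+1} = [G^i, G]$ for $i \ge 1$; $G$ has nilpotence class $l$ if $G^{l+1} = 1$ and $G^l > 1$. The quotient $n/l$ is a rational number (no rounding). *)

theory Defs
  imports "HOL-Algebra.Algebra"
begin

definition max_cyclic_subgroup :: "('a, 'b) monoid_scheme \<Rightarrow> 'a set \<Rightarrow> bool" where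
  "max_cyclic_subgroup G C \<longleftrightarrow>
     subgroup C G \<and> cyclic_group (G\<lparr>carrier := C\<rparr>) \<and>
     \<not> (\<exists>D. subgroup D G \<and> cyclic_group (G\<lparr>carrier := D\<rparr>) \<and> C \<subset> D)"

definition eta :: "('a, 'b) monoid_scheme \<Rightarrow> nat" where
  "eta G = card (orbits G {C. max_cyclic_subgroup G C}
     (\<lambda>g. \<lambda>H \<in> {H. subgroup H G}. g <#\<^bsub>G\<^esub> H #>\<^bsub>G\<^esub> inv\<^bsub>G\<^esub> g))"

text \<open>The commutator convention is the one of the library constant \<^const>\<open>derived\<close>, so that
  \<open>commutator_subgroup G H H\<close> is \<open>derived G H\<close>.\<close>

definition commutator_subgroup :: "('a, 'b) monoid_scheme \<Rightarrow> 'a set \<Rightarrow> 'a set \<Rightarrow> 'a set" where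
  "commutator_subgroup G H K =
     generate G (\<Union>h \<in> H. \<Union>k \<in> K. {h \<otimes>\<^bsub>G\<^esub> k \<otimes>\<^bsub>G\<^esub> inv\<^bsub>G\<^esub> h \<otimes>\<^bsub>G\<^esub> inv\<^bsub>G\<^esub> k})"

text \<open>The series starts at index 1; the value at index 0 is a dummy.\<close>

fun lower_central :: "('a, 'b) monoid_scheme \<Rightarrow> nat \<Rightarrow> 'a set" where
  "lower_central G 0 = carrier G"
| "lower_central G (Suc 0) = carrier G"
| "lower_central G (Suc (Suc i)) = commutator_subgroup G (lower_central G (Suc i)) (carrier G)"

text \<open>Only meaningful for \<open>l \<ge> 1\<close>.\<close>

definition has_nilpotence_class :: "('a, 'b) monoid_scheme \<Rightarrow> nat \<Rightarrow> bool" where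
  "has_nilpotence_class G l \<longleftrightarrow>
     lower_central G (l + 1) = {\<one>\<^bsub>G\<^esub>} \<and> lower_central G l \<noteq> {\<one>\<^bsub>G\<^esub>}"

end

theory Submission
  imports Defs
begin

text \<open>Write \<open>G\<^sup>i\<close> for the terms of the lower central series. Since \<open>p\<^sup>n\<close> is the product of
  the orders of the \<open>l\<close> factors \<open>G\<^sup>i/G\<^sup>i\<^sup>+\<^sup>1\<close>, one of them, \<open>A\<close> say, has order \<open>p\<^sup>m\<close> with
  \<open>m \<ge> n/l\<close>, and \<open>A\<close> is central in \<open>Q = G/G\<^sup>i\<^sup>+\<^sup>1\<close>. Three facts turn this into a bound on the
  number of conjugacy classes.

  A central section \<open>A\<close> has at most \<open>\<eta>(G)\<close> maximal cyclic subgroups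
  (\<open>card_max_cyclics_le_eta\<close>): sending a maximal cyclic subgroup \<open>C\<close> of \<open>G\<close> to the intersection
  of its image in \<open>Q\<close> with \<open>A\<close> is constant on conjugacy classes, because \<open>A\<close> is central, and
  every maximal cyclic subgroup of \<open>A\<close> is such an intersection.

  A noncyclic abelian group of order \<open>p\<^sup>m\<close> has at least \<open>2 + (p - 1)(m - 1)\<close> maximal cyclic
  subgroups (\<open>noncyclic_card_max_cyclics_ge\<close>): a chain of subgroups whose order grows by at most a
  factor \<open>p\<close> in each step gains at least \<open>p - 1\<close> maximal cyclic subgroups in each step. As
  \<open>2 + (p - 1)(m - 1) = (p - 1)(m - 2) + p + 1\<close>, this settles the case that \<open>A\<close> is noncyclic.

  If \<open>A\<close> is cyclic, the abelianization \<open>G/G\<^sup>2\<close> takes its place. It is noncyclic, since a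
  nilpotent group with cyclic abelianization is cyclic (\<open>cyclic_of_cyclic_abelianization\<close>). It is
  also large enough: \<open>|G/G\<^sup>2|\<close> annihilates every factor of the lower central series
  (\<open>pow_in_lower_central_Suc\<close>), so the order of a cyclic factor divides \<open>|G/G\<^sup>2|\<close>.\<close>

section \<open>Cyclic subgroups of a finite group\<close>

text \<open>The subset \<open>B\<close> stays inside the fixed ambient group \<open>G\<close>, so that subgroups of a chain and
  sections of a group can be compared without changing the group structure.\<close>
definition cyclic_subgroups_within :: "('a, 'b) monoid_scheme \<Rightarrow> 'a set \<Rightarrow> 'a set set" where
  "cyclic_subgroups_within G B = (\<lambda>x. generate G {x}) ` B"

definition max_cyclics :: "('a, 'b) monoid_scheme \<Rightarrow> 'a set \<Rightarrow> 'a set set" where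
  "max_cyclics G B = {C \<in> cyclic_subgroups_within G B.
     \<forall>D \<in> cyclic_subgroups_within G B. C \<subseteq> D \<longrightarrow> C = D}"

lemma finite_max_cyclics: "finite B \<Longrightarrow> finite (max_cyclics G B)"
  by (simp add: max_cyclics_def cyclic_subgroups_within_def)

lemma max_cyclics_above:
  assumes "finite B" "b \<in> B"
  obtains C where "C \<in> max_cyclics G B" "generate G {b} \<subseteq> C"
proof -
  have "finite (cyclic_subgroups_within G B)" "generate G {b} \<in> cyclic_subgroups_within G B"
    using assms by (auto simp: cyclic_subgroups_within_def)
  from finite_has_maximal2[OF this] show ?thesis
    using that by (auto simp: max_cyclics_def)
qed

context group
begin

lemma in_generate_singleton:
  assumes "finite (carrier G)" "x \<in> carrier G"
  shows "y \<in> generate G {x} \<longleftrightarrow> (\<exists>k::nat. y = x [^] k)"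
  using generate_pow_on_finite_carrier[OF assms] by auto

lemma self_in_generate: "x \<in> generate G {x}"
  by (simp add: generate.incl)

lemma generate_singleton_subset_iff:
  assumes "x \<in> carrier G" "y \<in> carrier G"
  shows "generate G {x} \<subseteq> generate G {y} \<longleftrightarrow> x \<in> generate G {y}"
  using generate_subgroup_incl[of "{x}" "generate G {y}"] generate_is_subgroup[of "{y}"]
    self_in_generate[of x] assms by auto

lemma subgroup_nat_pow_closed: "subgroup H G \<Longrightarrow> h \<in> H \<Longrightarrow> h [^] (k::nat) \<in> H"
  using subgroup_int_pow_closed[of H h "int k"] by (simp add: int_pow_int)

text \<open>Division with remainder: the least positive exponent \<open>k\<close> with \<open>c\<^sup>k \<in> H\<close> divides every
  exponent of \<open>c\<close> that leads into \<open>H\<close>.\<close>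
lemma subgroup_of_cyclic_is_cyclic:
  assumes fin: "finite (carrier G)" and c: "c \<in> carrier G"
    and H: "subgroup H G" "H \<subseteq> generate G {c}"
  obtains b where "b \<in> H" "H = generate G {b}"
proof -
  define k where "k = (LEAST k::nat. 0 < k \<and> c [^] k \<in> H)"
  have "0 < ord c \<and> c [^] ord c \<in> H"
    using ord_ge_1[OF fin c] c subgroup.one_closed[OF H(1)] by auto
  then have k: "0 < k" "c [^] k \<in> H"
    unfolding k_def by (metis (mono_tags, lifting) LeastI)+
  have least: "\<not> (0 < j \<and> c [^] j \<in> H)" if "j < k" for j
    using that not_less_Least unfolding k_def by blast
  have "h \<in> generate G {c [^] k}" if h: "h \<in> H" for h
  proof -
    obtain m :: nat where m: "h = c [^] m"
      using h H(2) in_generate_singleton[OF fin c] by blast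
    define q where "q = (c [^] k) [^] (m div k)"
    have q: "q \<in> H" "q \<in> carrier G"
      using k subgroup_nat_pow_closed[OF H(1)] c by (auto simp: q_def)
    have "h = q \<otimes> c [^] (m mod k)"
      using c by (simp add: m q_def nat_pow_pow nat_pow_mult)
    then have "c [^] (m mod k) = inv q \<otimes> h"
      using q c by (simp flip: m_assoc)
    then have "c [^] (m mod k) \<in> H"
      using q h H(1) by (simp add: subgroup.m_closed subgroup.m_inv_closed)
    then have "m mod k = 0"
      using least[of "m mod k"] k by auto
    then have "k * (m div k) = m"
      by auto
    then have "h = (c [^] k) [^] (m div k)"
      using c m by (simp add: nat_pow_pow)
    then show ?thesis
      using in_generate_singleton[OF fin, of "c [^] k"] c by blast
  qed
  moreover have "generate G {c [^] k} \<subseteq> H"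
    using generate_subgroup_incl[of "{c [^] k}" H] k H by auto
  ultimately show ?thesis
    using that[of "c [^] k"] k by auto
qed

lemma cyclic_group_subgroup_iff:
  assumes "subgroup C G"
  shows "cyclic_group (G\<lparr>carrier := C\<rparr>) \<longleftrightarrow> C \<in> cyclic_subgroups_within G C"
proof -
  interpret C: group "G\<lparr>carrier := C\<rparr>"
    using subgroup_imp_group[OF assms] .
  have "range (\<lambda>n::int. x [^]\<^bsub>G\<lparr>carrier := C\<rparr>\<^esub> n) = generate G {x}" if "x \<in> C" for x
    using that int_pow_consistent[OF assms that] subgroup.mem_carrier[OF assms that]
    by (auto simp: generate_pow)
  then show ?thesis
    unfolding C.cyclic_group cyclic_subgroups_within_def by auto
qed

lemma max_cyclic_subgroup_iff: "max_cyclic_subgroup G C \<longleftrightarrow> C \<in> max_cyclics G (carrier G)"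
proof -
  have "subgroup C G \<and> cyclic_group (G\<lparr>carrier := C\<rparr>) \<longleftrightarrow> C \<in> cyclic_subgroups_within G (carrier G)" for C
    using cyclic_group_subgroup_iff[of C] generate_is_subgroup self_in_generate subgroup.mem_carrier
    by (fastforce simp: cyclic_subgroups_within_def)
  then show ?thesis
    unfolding max_cyclic_subgroup_def max_cyclics_def by blast
qed

end

section \<open>Maximal cyclic subgroups of central sections\<close>

text \<open>The map \<open>C \<mapsto> h(C) \<inter> A\<close> is invariant under conjugation: elements of \<open>A\<close> commute with the
  image of \<open>h\<close>, so an element of \<open>C\<close> mapped into \<open>A\<close> keeps its image when it is conjugated. To reach
  a maximal cyclic subgroup \<open>D\<close> of \<open>A\<close>, lift a generator to \<open>G\<close> and take \<open>C\<close> maximal cyclic above the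
  lift; then \<open>h(C) \<inter> A\<close> is a cyclic subgroup of \<open>A\<close> that contains \<open>D\<close>, hence equals \<open>D\<close>.\<close>
lemma (in group_hom) card_max_cyclics_le_eta:
  assumes finG: "finite (carrier G)" and finH: "finite (carrier H)"
    and A: "subgroup A H" "A \<subseteq> h ` carrier G"
    and central: "\<And>a g. a \<in> A \<Longrightarrow> g \<in> carrier G \<Longrightarrow> a \<otimes>\<^bsub>H\<^esub> h g = h g \<otimes>\<^bsub>H\<^esub> a"
  shows "card (max_cyclics H A) \<le> eta G"
proof -
  define act where "act = (\<lambda>g. \<lambda>K \<in> {K. subgroup K G}. g <# K #> inv g)"
  define Orb where "Orb = orbits G {C. max_cyclic_subgroup G C} act"
  define F where "F K = h ` K \<inter> A" for K
  have sub: "subgroup C G" if "max_cyclic_subgroup G C" for C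
    using that by (simp add: max_cyclic_subgroup_def)
  have F_orbit: "F C' = F C" if C: "max_cyclic_subgroup G C" and C': "C' \<in> orbit G act C" for C C'
  proof -
    obtain g where g: "g \<in> carrier G" and "C' = act g C"
      using C' by (auto simp: orbit_def)
    then have C'_eq: "C' = (\<lambda>c. g \<otimes> c \<otimes> inv g) ` C"
      using sub[OF C] by (auto simp: act_def l_coset_def r_coset_def)
    have fixed: "h (g \<otimes> c \<otimes> inv g) = h c"
      if c: "c \<in> carrier G" and "h c \<in> A \<or> h (g \<otimes> c \<otimes> inv g) \<in> A" for c
      using that(2)
    proof
      assume "h c \<in> A"
      then show ?thesis
        using central[OF _ g, of "h c", symmetric] c g by (simp add: H.m_assoc)
    next
      assume a: "h (g \<otimes> c \<otimes> inv g) \<in> A"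
      have "h (g \<otimes> c \<otimes> inv g) \<otimes>\<^bsub>H\<^esub> h g = h g \<otimes>\<^bsub>H\<^esub> h c"
        using c g by (simp add: H.m_assoc)
      then have "h g \<otimes>\<^bsub>H\<^esub> h (g \<otimes> c \<otimes> inv g) = h g \<otimes>\<^bsub>H\<^esub> h c"
        using central[OF a g] by simp
      then show ?thesis
        using c g by (simp del: hom_mult)
    qed
    have Cc: "\<And>c. c \<in> C \<Longrightarrow> c \<in> carrier G"
      using subgroup.mem_carrier[OF sub[OF C]] .
    show ?thesis
      unfolding F_def C'_eq
    proof (intro equalityI subsetI)
      fix a assume "a \<in> h ` (\<lambda>c. g \<otimes> c \<otimes> inv g) ` C \<inter> A"
      then show "a \<in> h ` C \<inter> A"
        using fixed Cc by auto
    next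
      fix a assume "a \<in> h ` C \<inter> A"
      then obtain c where "c \<in> C" "a = h c" "a \<in> A"
        by auto
      then show "a \<in> h ` (\<lambda>c. g \<otimes> c \<otimes> inv g) ` C \<inter> A"
        using fixed[of c] Cc[of c] by (auto simp: image_image intro!: rev_image_eqI[of c])
    qed
  qed
  have self_orbit: "C \<in> orbit G act C" if "max_cyclic_subgroup G C" for C
  proof -
    have "act \<one> C = C"
      using sub[OF that] subgroup.subset[OF sub[OF that]]
      by (simp add: act_def G.lcos_mult_one)
    then show ?thesis
      unfolding orbit_def using G.one_closed by force
  qed
  (* Any representative of an orbit serves, because F is constant on it. *)
  have hit: "D \<in> (\<lambda>S. F (SOME C. C \<in> S)) ` Orb" if D: "D \<in> max_cyclics H A" for D
  proof -
    obtain a where a: "a \<in> A" "D = generate H {a}"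
      using D by (auto simp: max_cyclics_def cyclic_subgroups_within_def)
    then obtain g where g: "g \<in> carrier G" "a = h g"
      using A by auto
    obtain C where C: "C \<in> max_cyclics G (carrier G)" "generate G {g} \<subseteq> C"
      using max_cyclics_above[OF finG g(1)] .
    then obtain c where c: "c \<in> carrier G" "C = generate G {c}"
      by (auto simp: max_cyclics_def cyclic_subgroups_within_def)
    have maxC: "max_cyclic_subgroup G C"
      using C G.max_cyclic_subgroup_iff by simp
    have img: "h ` C = generate H {h c}"
      using generate_img[of "{c}"] c by simp
    have subF: "subgroup (F C) H"
      unfolding F_def img using H.generate_is_subgroup[of "{h c}"] c A H.subgroups_Inter_pair by auto
    obtain b where b: "b \<in> F C" "F C = generate H {b}"
      using H.subgroup_of_cyclic_is_cyclic[OF finH _ subF, of "h c"] c img by (auto simp: F_def)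
    have "F C \<in> cyclic_subgroups_within H A"
      using b by (auto simp: cyclic_subgroups_within_def F_def)
    moreover have "a \<in> F C"
      using a g C(2) G.self_in_generate[of g] by (auto simp: F_def)
    then have "D \<subseteq> F C"
      using H.generate_subgroup_incl[OF _ subF, of "{a}"] a by auto
    ultimately have "D = F C"
      using D by (auto simp: max_cyclics_def)
    moreover have "F (SOME C'. C' \<in> orbit G act C) = F C"
      using F_orbit[OF maxC] self_orbit[OF maxC] someI by metis
    moreover have "orbit G act C \<in> Orb"
      using maxC by (auto simp: Orb_def orbits_def)
    ultimately show ?thesis
      by (metis image_eqI)
  qed
  have "finite {C. max_cyclic_subgroup G C}"
    using finite_max_cyclics[OF finG, of G] by (simp add: G.max_cyclic_subgroup_iff)
  then have "finite Orb"
    by (simp add: Orb_def orbits_def)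
  then have "card (max_cyclics H A) \<le> card Orb"
    using surj_card_le[of Orb "max_cyclics H A"] hit by blast
  also have "card Orb = eta G"
    by (simp add: Orb_def eta_def act_def)
  finally show ?thesis .
qed

section \<open>Finite \<open>p\<close>-groups\<close>

locale finite_p_group = group +
  fixes p n :: nat
  assumes prime_p: "Factorial_Ring.prime p" and order_eq: "order G = p ^ n"
begin

lemma finite_carrier: "finite (carrier G)"
  using order_gt_0_iff_finite order_eq prime_gt_0_nat[OF prime_p] by simp

lemma in_generate_iff: "x \<in> carrier G \<Longrightarrow> y \<in> generate G {x} \<longleftrightarrow> (\<exists>k::nat. y = x [^] k)"
  using in_generate_singleton[OF finite_carrier] .

lemma ord_prime_power:
  assumes "x \<in> carrier G"
  obtains t where "ord x = p ^ t"
  using ord_dvd_group_order[OF assms] order_eq divides_primepow_nat[OF prime_p] by metis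

text \<open>An exponent prime to \<open>p\<close> is prime to the order of \<open>x\<close>, so both groups have the same order.\<close>
lemma generate_coprime_power:
  assumes x: "x \<in> carrier G" and k: "\<not> p dvd k"
  shows "generate G {x [^] k} = generate G {x}"
proof (rule card_subset_eq)
  show "finite (generate G {x})"
    using generate_incl[of "{x}"] x finite_carrier finite_subset by auto
  show "generate G {x [^] k} \<subseteq> generate G {x}"
    using x in_generate_iff[OF x] generate_singleton_subset_iff[of "x [^] k" x] by auto
  obtain t where "ord x = p ^ t"
    using ord_prime_power[OF x] .
  moreover have "coprime k p"
    using prime_imp_coprime[OF prime_p k] by (simp add: coprime_commute)
  ultimately have "coprime k (ord x)"
    by simp
  then have "ord (x [^] k) = ord x"
    using pow_ord_eq_ord_iff[OF finite_carrier x] by simp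
  then show "card (generate G {x [^] k}) = card (generate G {x})"
    using generate_pow_card x by simp
qed

text \<open>Hence an element that is not a \<open>p\<close>-th power generates a maximal cyclic subgroup.\<close>
lemma proper_cyclic_subgroup_power:
  assumes "x \<in> carrier G" "y \<in> carrier G" "generate G {x} \<subset> generate G {y}"
  obtains z where "z \<in> generate G {y}" "x = z [^] p"
proof -
  obtain k :: nat where k: "x = y [^] k"
    using assms(3) generate_singleton_subset_iff[OF assms(1,2)] in_generate_iff[OF assms(2)] by auto
  then have "p dvd k"
    using generate_coprime_power[OF assms(2), of k] assms(3) by auto
  then obtain j where "k = j * p"
    by (auto simp: dvd_def mult.commute)
  then have "x = (y [^] j) [^] p"
    using k assms(2) by (simp add: nat_pow_pow)
  then show ?thesis
    using that in_generate_iff[OF assms(2)] by blast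
qed

text \<open>A power \<open>c\<^sup>k\<close> with \<open>k\<close> prime to \<open>p\<close> generates \<open>c\<close>, so it lies outside \<open>B\<close> together with \<open>c\<close>.\<close>
lemma generate_inter_subgroup:
  assumes c: "c \<in> carrier G" "c [^] p \<in> B" "c \<notin> B" and B: "subgroup B G"
  shows "generate G {c} \<inter> B = generate G {c [^] p}"
proof (intro equalityI subsetI)
  fix z assume z: "z \<in> generate G {c} \<inter> B"
  then obtain k :: nat where k: "z = c [^] k"
    using in_generate_iff[OF c(1)] by blast
  have "p dvd k"
  proof (rule ccontr)
    assume "\<not> p dvd k"
    then have "c \<in> generate G {z}"
      using generate_coprime_power[OF c(1)] k self_in_generate by auto
    then show False
      using generate_subgroup_incl[of "{z}" B] z B c by auto
  qed
  then obtain j where "k = p * j"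
    by auto
  then have "z = (c [^] p) [^] j"
    using k c by (simp add: nat_pow_pow)
  then show "z \<in> generate G {c [^] p}"
    using in_generate_iff[of "c [^] p"] c by auto
next
  fix z assume z: "z \<in> generate G {c [^] p}"
  then have "z \<in> B"
    using generate_subgroup_incl[of "{c [^] p}" B] B c by auto
  moreover have "z \<in> generate G {c}"
    using z generate_singleton_subset_iff[of "c [^] p" c] in_generate_iff[OF c(1)] c(1) by auto
  ultimately show "z \<in> generate G {c} \<inter> B"
    by blast
qed

text \<open>A cyclic \<open>p\<close>-group has only one subgroup of order \<open>p\<close>. With \<open>ord y = p\<^sup>s\<^sup>+\<^sup>1\<close>, every solution of
  \<open>z\<^sup>p = 1\<close> in \<open>\<langle>y\<rangle>\<close> is a power of \<open>v = y\<^bsup>p^s\<^esup>\<close>, and the nontrivial ones generate \<open>\<langle>v\<rangle>\<close>.\<close>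
lemma order_p_elements_of_cyclic:
  assumes y: "y \<in> carrier G" and u: "u \<in> generate G {y}" "u [^] p = \<one>" "u \<noteq> \<one>"
    and w: "w \<in> generate G {y}" "w [^] p = \<one>"
  shows "w \<in> generate G {u}"
proof -
  obtain t where t: "ord y = p ^ t"
    using ord_prime_power[OF y] .
  have "t \<noteq> 0"
  proof
    assume "t = 0"
    then have "y = \<one>"
      using t ord_eq_1[OF y] by simp
    then show False
      using u generate_one by auto
  qed
  then obtain s where s: "t = Suc s"
    using not0_implies_Suc by blast
  define v where "v = y [^] (p ^ s)"
  have v: "v \<in> carrier G" "v [^] p = \<one>"
    using y t s by (auto simp: v_def nat_pow_pow pow_eq_id mult.commute)
  have *: "z \<in> generate G {v}" if z: "z \<in> generate G {y}" "z [^] p = \<one>" for z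
  proof -
    obtain k :: nat where k: "z = y [^] k"
      using z in_generate_iff[OF y] by blast
    then have "p ^ t dvd k * p"
      using z y t by (simp add: nat_pow_pow pow_eq_id)
    then have "p ^ s dvd k"
      using s prime_gt_0_nat[OF prime_p] by simp
    then show ?thesis
      using k y v(1) by (auto simp: in_generate_iff v_def nat_pow_pow)
  qed
  obtain i :: nat where i: "u = v [^] i"
    using *[OF u(1,2)] in_generate_iff[OF v(1)] by blast
  have "\<not> p dvd i"
  proof
    assume "p dvd i"
    then obtain j where "i = p * j" ..
    then have "u = (v [^] p) [^] j"
      using i v(1) by (simp add: nat_pow_pow)
    then show False
      using v u by simp
  qed
  then show ?thesis
    using generate_coprime_power[OF v(1)] i *[OF w] by simp
qed

end

section \<open>Noncyclic abelian \<open>p\<close>-groups\<close>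

locale finite_abelian_p_group = finite_p_group + comm_group
begin

text \<open>An abelian \<open>p\<close>-group with only one subgroup of order \<open>p\<close> is cyclic. Let \<open>g\<close> have maximal order
  \<open>p\<^sup>t\<close>; then \<open>p\<^sup>t\<close> annihilates the group. By induction on \<open>k \<le> t\<close>, all \<open>z\<close> with \<open>z\<^bsup>p^k\<^esup> = 1\<close> lie
  in \<open>\<langle>g\<rangle>\<close>: the power \<open>z\<^sup>p\<close> is \<open>g\<^sup>j\<^sup>p\<close> for some \<open>j\<close>, so \<open>z g\<^sup>-\<^sup>j\<close> has order at most \<open>p\<close> and
  lies in the unique subgroup of order \<open>p\<close>, which \<open>\<langle>g\<rangle>\<close> contains.\<close>
lemma independent_order_p_elements:
  assumes nc: "\<not> cyclic_group G"
  obtains u w where "u \<in> carrier G" "w \<in> carrier G" "u [^] p = \<one>" "w [^] p = \<one>" "u \<noteq> \<one>"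
    "w \<notin> generate G {u}"
proof -
  have "\<exists>u w. u \<in> carrier G \<and> w \<in> carrier G \<and> u [^] p = \<one> \<and> w [^] p = \<one> \<and> u \<noteq> \<one> \<and>
    w \<notin> generate G {u}"
  proof (rule ccontr)
    assume none: "\<not> ?thesis"
    have "finite (ord ` carrier G)" "ord ` carrier G \<noteq> {}"
      using finite_carrier one_closed by auto
    from Max_in[OF this] obtain g where g: "g \<in> carrier G" "ord g = Max (ord ` carrier G)"
      by auto
    obtain t where t: "ord g = p ^ t"
      using ord_prime_power[OF g(1)] .
    have z_t: "z [^] (p ^ t) = \<one>" if z: "z \<in> carrier G" for z
    proof -
      obtain s where s: "ord z = p ^ s"
        using ord_prime_power[OF z] .
      have "ord z \<le> ord g"
        using z g(2) finite_carrier by simp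
      then have "s \<le> t"
        using s t prime_gt_1_nat[OF prime_p] by simp
      then show ?thesis
        using z s by (simp add: pow_eq_id le_imp_power_dvd)
    qed
    have sub: "subgroup (generate G {g}) G"
      using generate_is_subgroup g by simp
    have "z \<in> generate G {g}" if "k \<le> t" "z \<in> carrier G" "z [^] (p ^ k) = \<one>" for k z
      using that
    proof (induction k arbitrary: z)
      case 0
      then show ?case
        using generate.one[of G] by simp
    next
      case (Suc k)
      have "z [^] p \<in> generate G {g}"
        using Suc by (simp add: nat_pow_pow)
      then obtain m :: nat where m: "z [^] p = g [^] m"
        using in_generate_iff[OF g(1)] by blast
      have "g [^] (m * p ^ k) = (z [^] p) [^] (p ^ k)"
        using m g by (simp add: nat_pow_pow)
      also have "\<dots> = \<one>"
        using Suc.prems by (simp add: nat_pow_pow)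
      finally have "p ^ t dvd m * p ^ k"
        using g t by (simp add: pow_eq_id)
      moreover have "p ^ Suc k dvd p ^ t"
        using Suc.prems le_imp_power_dvd by blast
      ultimately have "p ^ Suc k dvd m * p ^ k"
        using dvd_trans by blast
      then have "p dvd m"
        using prime_gt_0_nat[OF prime_p] by simp
      then obtain j where j: "m = j * p"
        by (auto simp: dvd_def mult.commute)
      define w where "w = z \<otimes> inv (g [^] j)"
      have w: "w \<in> carrier G" "w [^] p = \<one>"
        using Suc.prems g m j by (auto simp: w_def nat_pow_distrib nat_pow_inv nat_pow_pow)
      (* u generates the subgroup of order p of the group generated by g. *)
      define u where "u = g [^] (p ^ (t - 1))"
      have u: "u \<in> carrier G" "u [^] p = \<one>"
        using g t Suc.prems by (auto simp: u_def nat_pow_pow pow_eq_id simp flip: power_Suc2)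
      have "u \<noteq> \<one>"
      proof
        assume "u = \<one>"
        then have "p ^ t dvd p ^ (t - 1)"
          using g t by (simp add: u_def pow_eq_id)
        then have "t \<le> t - 1"
          using prime_gt_1_nat[OF prime_p] by (simp add: power_dvd_imp_le)
        then show False
          using Suc.prems by simp
      qed
      then have "w \<in> generate G {u}"
        using none u w by blast
      moreover have "generate G {u} \<subseteq> generate G {g}"
        using generate_singleton_subset_iff[OF u(1) g(1)] in_generate_iff[OF g(1)] u_def by auto
      moreover have "z = w \<otimes> g [^] j"
        using Suc.prems g by (simp add: w_def m_assoc)
      moreover have "g [^] j \<in> generate G {g}"
        using in_generate_iff[OF g(1)] by auto
      ultimately show ?case
        using subgroup.m_closed[OF sub] by auto
    qed
    then have "carrier G \<subseteq> generate G {g}"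
      using z_t by blast
    then have "carrier G = generate G {g}"
      using subgroup.subset[OF sub] by blast
    then have "carrier G \<in> cyclic_subgroups_within G (carrier G)"
      using g(1) unfolding cyclic_subgroups_within_def by blast
    then have "cyclic_group G"
      using cyclic_group_subgroup_iff[OF subgroup_self] by simp
    then show False
      using nc by simp
  qed
  then show ?thesis
    using that by blast
qed

text \<open>The group \<open>B\<langle>y\<rangle>\<close> is the union of the cosets \<open>B y\<^sup>i\<close> with \<open>i < p\<close>.\<close>
lemma adjoin_pth_root:
  assumes B: "subgroup B G" and y: "y \<in> carrier G" "y [^] p \<in> B"
  obtains B' where "subgroup B' G" "B \<subseteq> B'" "y \<in> B'" "\<And>x. x \<in> B' \<Longrightarrow> x [^] p \<in> B"
    "card B' \<le> p * card B"
proof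
  let ?Y = "generate G {y}"
  have Y: "subgroup ?Y G"
    using generate_is_subgroup y by simp
  have finB: "finite B"
    using subgroup.subset[OF B] finite_carrier finite_subset by blast
  have Bc: "\<And>b. b \<in> B \<Longrightarrow> b \<in> carrier G"
    using subgroup.mem_carrier[OF B] .
  have form: "\<exists>b \<in> B. \<exists>i < p. x = b \<otimes> y [^] i" if x: "x \<in> B <#> ?Y" for x
  proof -
    obtain b z where "b \<in> B" "z \<in> ?Y" "x = b \<otimes> z"
      using x by (auto simp: set_mult_def)
    then obtain k :: nat where b: "b \<in> B" "x = b \<otimes> y [^] k"
      using in_generate_iff[OF y(1), of z] by blast
    have "y [^] k = y [^] (p * (k div p)) \<otimes> y [^] (k mod p)"
      using y by (simp add: nat_pow_mult)
    then have "x = (b \<otimes> (y [^] p) [^] (k div p)) \<otimes> y [^] (k mod p)"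
      using b y Bc by (simp add: nat_pow_pow m_assoc)
    moreover have "b \<otimes> (y [^] p) [^] (k div p) \<in> B"
      using b y B subgroup_nat_pow_closed subgroup.m_closed by metis
    moreover have "k mod p < p"
      using prime_gt_0_nat[OF prime_p] by simp
    ultimately show ?thesis
      by blast
  qed
  show "subgroup (B <#> ?Y) G"
    using mult_subgroups B Y by blast
  have mem: "b \<otimes> z \<in> B <#> ?Y" if "b \<in> B" "z \<in> ?Y" for b z
    using that by (auto simp: set_mult_def)
  show "B \<subseteq> B <#> ?Y"
    using mem[OF _ subgroup.one_closed[OF Y]] Bc by auto
  show "y \<in> B <#> ?Y"
    using mem[OF subgroup.one_closed[OF B] self_in_generate] y by simp
  show "x [^] p \<in> B" if x: "x \<in> B <#> ?Y" for x
  proof -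
    obtain b i where b: "b \<in> B" "x = b \<otimes> y [^] (i::nat)"
      using form[OF x] by blast
    then have "x [^] p = b [^] p \<otimes> (y [^] p) [^] i"
      using y Bc by (simp add: nat_pow_distrib nat_pow_pow mult.commute)
    then show ?thesis
      using b y B subgroup_nat_pow_closed subgroup.m_closed by metis
  qed
  have "B <#> ?Y \<subseteq> (\<lambda>(b, i). b \<otimes> y [^] i) ` (B \<times> {..<p})"
    using form by force
  then have "card (B <#> ?Y) \<le> card (B \<times> {..<p})"
    using finB by (meson card_image_le card_mono finite_SigmaI finite_imageI finite_lessThan le_trans)
  then show "card (B <#> ?Y) \<le> p * card B"
    by (simp add: card_cartesian_product mult.commute)
qed

text \<open>Since all \<open>p\<close>-th powers of \<open>B'\<close> lie in \<open>B\<close>, each element outside \<open>B\<close> generates a maximal cyclic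
  subgroup of \<open>B'\<close>. Applied to \<open>y u\<^sup>i\<close> with \<open>i < p\<close>, this gives \<open>p\<close> maximal cyclic subgroups, all of
  which meet \<open>B\<close> in \<open>\<langle>y\<^sup>p\<rangle>\<close>. They are distinct: if two of them agreed, the common group would
  contain \<open>u\<close>, which would then lie in \<open>\<langle>y\<^sup>p\<rangle>\<close>. Every other maximal cyclic subgroup of \<open>B\<close> is the
  intersection with \<open>B\<close> of a further maximal cyclic subgroup of \<open>B'\<close>.\<close>
lemma card_max_cyclics_overgroup:
  assumes B: "subgroup B G" and B': "subgroup B' G" "B \<subseteq> B'" "\<And>x. x \<in> B' \<Longrightarrow> x [^] p \<in> B"
    and y: "y \<in> B'" "y \<notin> B" and u: "u \<in> B" "u [^] p = \<one>" "u \<notin> generate G {y}"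
  shows "p + card (max_cyclics G B - {generate G {y [^] p}}) \<le> card (max_cyclics G B')"
proof -
  have B'c: "\<And>b. b \<in> B' \<Longrightarrow> b \<in> carrier G"
    using subgroup.mem_carrier[OF B'(1)] .
  have Bc: "\<And>b. b \<in> B \<Longrightarrow> b \<in> carrier G"
    using B' B'c by blast
  have finB': "finite B'"
    using finite_subset[OF subgroup.subset[OF B'(1)] finite_carrier] .
  then have finB: "finite B"
    using finite_subset[OF B'(2)] by blast
  have max_outside: "generate G {c} \<in> max_cyclics G B'" if c: "c \<in> B'" "c \<notin> B" for c
  proof -
    have "generate G {c} = generate G {d}"
      if d: "d \<in> B'" "generate G {c} \<subseteq> generate G {d}" for d
    proof (rule ccontr)
      assume "generate G {c} \<noteq> generate G {d}"
      then obtain z where z: "z \<in> generate G {d}" "c = z [^] p"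
        using proper_cyclic_subgroup_power[of c d] d c B'c by blast
      then have "z \<in> B'"
        using generate_subgroup_incl[of "{d}" B'] d B' by auto
      then show False
        using B'(3) z c by blast
    qed
    then show ?thesis
      using c by (auto simp: max_cyclics_def cyclic_subgroups_within_def)
  qed
  define c where "c i = y \<otimes> u [^] i" for i :: nat
  have c_in: "c i \<in> B'" "c i \<notin> B" for i
  proof -
    have ui: "u [^] i \<in> B"
      using subgroup_nat_pow_closed[OF B] u by blast
    show "c i \<in> B'"
      using subgroup.m_closed[OF B'(1)] y ui B'(2) by (auto simp: c_def)
    show "c i \<notin> B"
    proof
      assume "c i \<in> B"
      then have "c i \<otimes> inv (u [^] i) \<in> B"
        using ui subgroup.m_closed[OF B] subgroup.m_inv_closed[OF B] by blast
      then show False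
        using y B'c Bc u by (simp add: c_def m_assoc)
    qed
  qed
  have c_pow: "c i [^] p = y [^] p" for i
  proof -
    have "(u [^] i) [^] p = (u [^] p) [^] i"
      using Bc[OF u(1)] by (simp add: nat_pow_pow mult.commute)
    then show ?thesis
      using y B'c Bc u by (simp add: c_def nat_pow_distrib)
  qed
  have c_inter: "generate G {c i} \<inter> B = generate G {y [^] p}" for i
    using generate_inter_subgroup[of "c i" B] c_in B'c B'(3) B c_pow by metis
  have c_distinct: "generate G {c i} \<noteq> generate G {c j}" if ij: "i < j" "j < p" for i j
  proof
    assume eq: "generate G {c i} = generate G {c j}"
    have sub: "subgroup (generate G {c i}) G"
      using generate_is_subgroup c_in B'c by simp
    have uc: "u \<in> carrier G" and yc: "y \<in> carrier G"
      using u y Bc B'c by auto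
    have "c j = c i \<otimes> u [^] (j - i)"
      using ij uc yc by (simp add: c_def m_assoc nat_pow_mult)
    then have "u [^] (j - i) = inv (c i) \<otimes> c j"
      using uc B'c c_in by (simp flip: m_assoc)
    also have "\<dots> \<in> generate G {c i}"
      using subgroup.m_closed[OF sub] subgroup.m_inv_closed[OF sub] self_in_generate eq by metis
    finally have "generate G {u [^] (j - i)} \<subseteq> generate G {c i}"
      using generate_subgroup_incl[OF _ sub] by simp
    moreover have "\<not> p dvd (j - i)"
      using ij by (auto dest: dvd_imp_le)
    ultimately have "u \<in> generate G {c i}"
      using generate_coprime_power[OF uc] self_in_generate by auto
    then have "u \<in> generate G {y [^] p}"
      using c_inter[of i] u by auto
    moreover have "generate G {y [^] p} \<subseteq> generate G {y}"
      using generate_singleton_subset_iff[of "y [^] p" y] in_generate_iff[OF yc] yc by auto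
    ultimately show False
      using u by blast
  qed
  define P where "P = (\<lambda>i. generate G {c i}) ` {..<p}"
  have cardP: "card P = p"
    unfolding P_def using c_distinct by (subst card_image) (auto intro!: linorder_inj_onI)
  have "\<exists>C \<in> max_cyclics G B'. C \<inter> B = D" if D: "D \<in> max_cyclics G B" for D
  proof -
    obtain b where b: "b \<in> B" "D = generate G {b}"
      using D by (auto simp: max_cyclics_def cyclic_subgroups_within_def)
    obtain C where C: "C \<in> max_cyclics G B'" "D \<subseteq> C"
      using max_cyclics_above[OF finB', of b G] b B'(2) by blast
    then obtain d where d: "d \<in> B'" "C = generate G {d}"
      by (auto simp: max_cyclics_def cyclic_subgroups_within_def)
    have sub: "subgroup (C \<inter> B) G"
      using subgroups_Inter_pair[OF _ B] generate_is_subgroup[of "{d}"] d B'c by simp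
    obtain e where "e \<in> C \<inter> B" "C \<inter> B = generate G {e}"
      using subgroup_of_cyclic_is_cyclic[OF finite_carrier _ sub, of d] d B'c by auto
    then have "C \<inter> B \<in> cyclic_subgroups_within G B"
      by (auto simp: cyclic_subgroups_within_def)
    moreover have "D \<subseteq> C \<inter> B"
      using C generate_subgroup_incl[OF _ B, of "{b}"] b by auto
    ultimately have "D = C \<inter> B"
      using D by (auto simp: max_cyclics_def)
    then show ?thesis
      using C by blast
  qed
  then obtain E where E: "\<And>D. D \<in> max_cyclics G B \<Longrightarrow> E D \<in> max_cyclics G B' \<and> E D \<inter> B = D"
    by metis
  define M where "M = max_cyclics G B - {generate G {y [^] p}}"
  have "inj_on E M"
    using E unfolding M_def by (metis DiffD1 inj_onI)
  then have cardM: "card (E ` M) = card M"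
    by (rule card_image)
  have disj: "P \<inter> E ` M = {}"
    using E c_inter unfolding P_def M_def by fastforce
  have "P \<union> E ` M \<subseteq> max_cyclics G B'"
    using E max_outside c_in by (auto simp: P_def M_def)
  then have "card (P \<union> E ` M) \<le> card (max_cyclics G B')"
    using card_mono finite_max_cyclics[OF finB'] by blast
  moreover have "finite P" "finite (E ` M)"
    using finite_max_cyclics[OF finB] by (auto simp: P_def M_def)
  then have "card (P \<union> E ` M) = p + card M"
    using card_Un_disjoint[OF _ _ disj] cardP cardM by simp
  ultimately show ?thesis
    by (simp add: M_def)
qed

text \<open>Start from two independent elements \<open>u\<close>, \<open>w\<close> of order \<open>p\<close> and pass from a proper subgroup \<open>B\<close>
  containing them to \<open>B\<langle>y\<rangle>\<close>, where \<open>y \<notin> B\<close> and \<open>y\<^sup>p \<in> B\<close>. As \<open>\<langle>y\<rangle>\<close> has at most one subgroup of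
  order \<open>p\<close>, it misses \<open>u\<close> or \<open>w\<close>. So \<open>p\<close> new maximal cyclic subgroups appear and at most one old
  one is lost.\<close>
theorem noncyclic_card_max_cyclics_ge:
  assumes nc: "\<not> cyclic_group G"
  shows "2 + (p - 1) * (n - 1) \<le> card (max_cyclics G (carrier G))"
proof -
  obtain u w where uw: "u \<in> carrier G" "w \<in> carrier G" "u [^] p = \<one>" "w [^] p = \<one>" "u \<noteq> \<one>"
    "w \<notin> generate G {u}"
    using independent_order_p_elements[OF nc] .
  define good where "good B \<longleftrightarrow> subgroup B G \<and> u \<in> B \<and> w \<in> B \<and>
    (\<exists>k \<ge> 1. card B \<le> p ^ k \<and> 2 + (p - 1) * (k - 1) \<le> card (max_cyclics G B))" for B
  have p1: "1 < p"
    using prime_gt_1_nat[OF prime_p] .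
  (* The step from U = <u> to U<w> gains the full p: the subgroup <w^p> = 1 that the p new
     subgroups sit above is not maximal cyclic in U. *)
  have start: "\<exists>B. good B"
  proof -
    define U where "U = generate G {u}"
    have U: "subgroup U G" "u \<in> U" "w \<notin> U"
      using generate_is_subgroup[of "{u}"] uw self_in_generate by (auto simp: U_def)
    have w_pow: "w [^] p \<in> U"
      using uw subgroup.one_closed[OF U(1)] by simp
    obtain B where B: "subgroup B G" "U \<subseteq> B" "w \<in> B" "\<And>x. x \<in> B \<Longrightarrow> x [^] p \<in> U"
      "card B \<le> p * card U"
      using adjoin_pth_root[OF U(1) uw(2) w_pow] by blast
    have "u \<notin> generate G {w}"
      using order_p_elements_of_cyclic[OF uw(2) _ uw(3,5) self_in_generate uw(4)] uw by blast
    from card_max_cyclics_overgroup[OF U(1) B(1,2,4) B(3) U(3,2) uw(3) this]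
    have step_le: "p + card (max_cyclics G U - {{\<one>}}) \<le> card (max_cyclics G B)"
      using uw generate_one by simp
    have "U \<in> max_cyclics G U"
      using generate_subgroup_incl[OF _ U(1)] U(2)
      by (auto simp: max_cyclics_def cyclic_subgroups_within_def U_def)
    then have "max_cyclics G U - {{\<one>}} \<noteq> {}"
      using U uw by auto
    moreover have "finite (max_cyclics G U - {{\<one>}})"
      using finite_max_cyclics[OF finite_subset[OF subgroup.subset[OF U(1)] finite_carrier]]
      by blast
    ultimately have "card (max_cyclics G U - {{\<one>}}) \<noteq> 0"
      by (simp only: card_0_eq not_False_eq_True)
    with step_le have "2 + (p - 1) * (2 - 1) \<le> card (max_cyclics G B)"
      using p1 by simp
    moreover have "card U \<le> p"
      using generate_pow_card[OF uw(1)] uw pow_eq_id[OF uw(1), of p] p1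
      by (auto simp: U_def intro!: dvd_imp_le)
    then have "p * card U \<le> p ^ 2"
      by (simp add: power2_eq_square)
    then have "card B \<le> p ^ 2"
      using B(5) by linarith
    ultimately have "good B"
      using B U unfolding good_def by (auto intro!: exI[of _ 2])
    then show ?thesis
      by blast
  qed
  have extend: "\<exists>B'. good B' \<and> B \<subset> B'" if B: "good B" "B \<noteq> carrier G" for B
  proof -
    have sub: "subgroup B G" and uwB: "u \<in> B" "w \<in> B"
      using B(1) by (auto simp: good_def)
    obtain k where k: "k \<ge> 1" "card B \<le> p ^ k" "2 + (p - 1) * (k - 1) \<le> card (max_cyclics G B)"
      using B(1) by (auto simp: good_def)
    obtain x where x: "x \<in> carrier G" "x \<notin> B"
      using B(2) subgroup.subset[OF sub] by blast
    have "x [^] (p ^ n) \<in> B"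
      using pow_order_eq_1[OF x(1)] order_eq subgroup.one_closed[OF sub] by simp
    moreover have "x [^] (p ^ 0) \<notin> B"
      using x by simp
    ultimately obtain j where j: "x [^] (p ^ j) \<notin> B" "x [^] (p ^ Suc j) \<in> B"
      using ex_least_nat_less[of "\<lambda>i. x [^] (p ^ i) \<in> B" n] by auto
    define y where "y = x [^] (p ^ j)"
    have y: "y \<in> carrier G" "y \<notin> B" "y [^] p \<in> B"
      using x j by (auto simp: y_def nat_pow_pow mult.commute)
    obtain B' where B': "subgroup B' G" "B \<subseteq> B'" "y \<in> B'" "\<And>x. x \<in> B' \<Longrightarrow> x [^] p \<in> B"
      "card B' \<le> p * card B"
      using adjoin_pth_root[OF sub y(1,3)] by blast
    have "\<not> (u \<in> generate G {y} \<and> w \<in> generate G {y})"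
      using order_p_elements_of_cyclic[OF y(1)] uw by blast
    then obtain v where v: "v \<in> B" "v [^] p = \<one>" "v \<notin> generate G {y}"
      using uwB uw by blast
    have "p + card (max_cyclics G B - {generate G {y [^] p}}) \<le> card (max_cyclics G B')"
      using card_max_cyclics_overgroup[OF sub B'(1,2,4,3) y(2) v] by blast
    moreover have "card (max_cyclics G B) - 1 \<le> card (max_cyclics G B - {generate G {y [^] p}})"
      by (simp add: card_Diff_singleton_if)
    ultimately have "2 + (p - 1) * (k - 1) + (p - 1) \<le> card (max_cyclics G B')"
      using k(3) p1 by linarith
    moreover have "(p - 1) * (k - 1) + (p - 1) = (p - 1) * (Suc k - 1)"
      using k(1) by (cases k) auto
    moreover have "card B' \<le> p ^ Suc k"
      using B'(5) k(2) by (simp add: le_trans)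
    ultimately have "good B'"
      unfolding good_def using B' uwB by (auto intro!: exI[of _ "Suc k"])
    then show ?thesis
      using B' y by blast
  qed
  have "finite {B. good B}"
    by (rule finite_subset[of _ "Pow (carrier G)"])
      (auto simp: good_def finite_carrier dest: subgroup.subset)
  then obtain B where B: "good B" "\<And>B'. good B' \<Longrightarrow> B \<subseteq> B' \<Longrightarrow> B = B'"
    using finite_has_maximal[of "{B. good B}"] start by auto
  then have "B = carrier G"
    using extend by blast
  then obtain k where k: "card (carrier G) \<le> p ^ k"
    "2 + (p - 1) * (k - 1) \<le> card (max_cyclics G (carrier G))"
    using B(1) by (auto simp: good_def)
  have "n \<le> k"
    using k(1) order_eq p1 by (simp add: order_def)
  then have "(p - 1) * (n - 1) \<le> (p - 1) * (k - 1)"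
    using diff_le_mono mult_le_mono2 by blast
  then show ?thesis
    using k(2) by linarith
qed

end

section \<open>The lower central series\<close>

context group
begin

lemma commutator_subgroup_normal:
  assumes H: "H \<lhd> G"
  shows "commutator_subgroup G H (carrier G) \<lhd> G"
  unfolding commutator_subgroup_def
proof (rule normal_generateI)
  have Hc: "\<And>x. x \<in> H \<Longrightarrow> x \<in> carrier G"
    using subgroup.mem_carrier[OF normal_imp_subgroup[OF H]] .
  show "(\<Union>h\<in>H. \<Union>k\<in>carrier G. {h \<otimes> k \<otimes> inv h \<otimes> inv k}) \<subseteq> carrier G"
    using Hc by auto
  fix c g assume c: "c \<in> (\<Union>h\<in>H. \<Union>k\<in>carrier G. {h \<otimes> k \<otimes> inv h \<otimes> inv k})" and g: "g \<in> carrier G"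
  obtain h k where hk: "h \<in> H" "k \<in> carrier G" "c = h \<otimes> k \<otimes> inv h \<otimes> inv k"
    using c by auto
  define h' k' where "h' = g \<otimes> h \<otimes> inv g" and "k' = g \<otimes> k \<otimes> inv g"
  have "g \<otimes> c \<otimes> inv g = h' \<otimes> k' \<otimes> inv h' \<otimes> inv k'"
    using hk g Hc[OF hk(1)] unfolding h'_def k'_def
    by (simp add: inv_mult_group m_assoc inv_solve_left' flip: m_assoc[of "inv g" g])
  moreover have "h' \<in> H"
    using normal.inv_op_closed2[OF H g hk(1)] by (simp add: h'_def)
  moreover have "k' \<in> carrier G"
    using hk g by (simp add: k'_def)
  ultimately show "g \<otimes> c \<otimes> inv g \<in> (\<Union>h\<in>H. \<Union>k\<in>carrier G. {h \<otimes> k \<otimes> inv h \<otimes> inv k})"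
    by auto
qed

lemma commutator_subgroup_le:
  assumes H: "H \<lhd> G"
  shows "commutator_subgroup G H (carrier G) \<subseteq> H"
  unfolding commutator_subgroup_def
proof (rule generate_subgroup_incl[OF _ normal_imp_subgroup[OF H]])
  have sub: "subgroup H G"
    using normal_imp_subgroup[OF H] .
  have "h \<otimes> k \<otimes> inv h \<otimes> inv k \<in> H" if "h \<in> H" "k \<in> carrier G" for h k
  proof -
    have "k \<otimes> inv h \<otimes> inv k \<in> H"
      using normal.inv_op_closed2[OF H] that subgroup.m_inv_closed[OF sub] by blast
    then have "h \<otimes> (k \<otimes> inv h \<otimes> inv k) \<in> H"
      using subgroup.m_closed[OF sub] that by blast
    then show ?thesis
      using that subgroup.mem_carrier[OF sub] by (simp add: m_assoc)
  qed
  then show "(\<Union>h\<in>H. \<Union>k\<in>carrier G. {h \<otimes> k \<otimes> inv h \<otimes> inv k}) \<subseteq> H"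
    by auto
qed

lemma lower_central_normal: "lower_central G i \<lhd> G"
proof (induction i)
  case 0
  then show ?case
    using normal_self by simp
next
  case (Suc i)
  then show ?case
    using normal_self commutator_subgroup_normal by (cases i) auto
qed

lemma lower_central_Suc:
  "i \<ge> 1 \<Longrightarrow> lower_central G (Suc i) = commutator_subgroup G (lower_central G i) (carrier G)"
  by (cases i) auto

lemma lower_central_decreasing: "i \<ge> 1 \<Longrightarrow> lower_central G (Suc i) \<subseteq> lower_central G i"
  using commutator_subgroup_le[OF lower_central_normal] lower_central_Suc by simp

lemma commutator_in_lower_central:
  assumes "i \<ge> 1" "x \<in> lower_central G i" "g \<in> carrier G"
  shows "x \<otimes> g \<otimes> inv x \<otimes> inv g \<in> lower_central G (Suc i)"
  unfolding lower_central_Suc[OF assms(1)] commutator_subgroup_def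
  using assms by (auto intro!: generate.incl)

lemma lower_central_le:
  assumes i: "i \<ge> 1" and N: "subgroup N G"
    and "\<And>x g. x \<in> lower_central G i \<Longrightarrow> g \<in> carrier G \<Longrightarrow> x \<otimes> g \<otimes> inv x \<otimes> inv g \<in> N"
  shows "lower_central G (Suc i) \<subseteq> N"
  unfolding lower_central_Suc[OF i] commutator_subgroup_def
  using assms(3) by (intro generate_subgroup_incl[OF _ N]) auto

lemma coset_eq_one_iff:
  assumes "N \<lhd> G" "x \<in> carrier G"
  shows "N #> x = N \<longleftrightarrow> x \<in> N"
  using coset_join1[of N x] coset_join2[of x N] assms normal_imp_subgroup[OF assms(1)]
    subgroup.subset by auto

lemma quotient_group_hom:
  assumes "N \<lhd> G"
  shows "group_hom G (G Mod N) ((#>) N)"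
  using normal.r_coset_hom_Mod[OF assms] normal.factorgroup_is_group[OF assms] is_group
  by (simp add: group_hom_def group_hom_axioms_def)

text \<open>Centrality of the lower central factors is used in quotients, but their definition speaks of
  commutators in \<open>G\<close>; this is the bridge.\<close>
lemma commute_in_quotient_iff:
  assumes N: "N \<lhd> G" and xy: "x \<in> carrier G" "y \<in> carrier G"
  shows "(N #> x) \<otimes>\<^bsub>G Mod N\<^esub> (N #> y) = (N #> y) \<otimes>\<^bsub>G Mod N\<^esub> (N #> x) \<longleftrightarrow>
    x \<otimes> y \<otimes> inv x \<otimes> inv y \<in> N"
proof -
  interpret q: group_hom G "G Mod N" "(#>) N"
    using quotient_group_hom[OF N] .
  have "(N #> x) \<otimes>\<^bsub>G Mod N\<^esub> (N #> y) = (N #> y) \<otimes>\<^bsub>G Mod N\<^esub> (N #> x) \<longleftrightarrow>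
    N #> (x \<otimes> y) = N #> (y \<otimes> x)"
    using q.hom_mult[OF xy] q.hom_mult[OF xy(2,1)] by simp
  also have "\<dots> \<longleftrightarrow> N #> ((x \<otimes> y) \<otimes> inv (y \<otimes> x)) = N"
  proof -
    have "N #> ((x \<otimes> y) \<otimes> inv (y \<otimes> x)) = (N #> (x \<otimes> y)) \<otimes>\<^bsub>G Mod N\<^esub> inv\<^bsub>G Mod N\<^esub> (N #> (y \<otimes> x))"
      using q.hom_mult[of "x \<otimes> y" "inv (y \<otimes> x)"] xy by simp
    also have "\<dots> = N \<longleftrightarrow> N #> (x \<otimes> y) = N #> (y \<otimes> x)"
      using q.H.inv_solve_right'[of "\<one>\<^bsub>G Mod N\<^esub>" "N #> (x \<otimes> y)" "N #> (y \<otimes> x)"]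
        q.hom_closed[of "x \<otimes> y"] q.hom_closed[of "y \<otimes> x"] xy
      by (metis m_closed one_FactGroup q.H.l_one q.H.one_closed)
    finally show ?thesis
      by simp
  qed
  also have "\<dots> \<longleftrightarrow> x \<otimes> y \<otimes> inv x \<otimes> inv y \<in> N"
    using coset_eq_one_iff[OF N, of "(x \<otimes> y) \<otimes> inv (y \<otimes> x)"] xy
    by (simp add: inv_mult_group m_assoc)
  finally show ?thesis .
qed

lemma lower_central_central_mod:
  assumes "i \<ge> 1" "x \<in> lower_central G i" "g \<in> carrier G"
  shows "(lower_central G (Suc i) #> x) \<otimes>\<^bsub>G Mod lower_central G (Suc i)\<^esub> (lower_central G (Suc i) #> g) =
    (lower_central G (Suc i) #> g) \<otimes>\<^bsub>G Mod lower_central G (Suc i)\<^esub> (lower_central G (Suc i) #> x)"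
  using commute_in_quotient_iff[OF lower_central_normal] commutator_in_lower_central[OF assms] assms
    normal_imp_subgroup[OF lower_central_normal] subgroup.mem_carrier by metis

lemma card_quotient_image:
  assumes N: "N \<lhd> G" "N \<subseteq> H" and H: "subgroup H G"
  shows "card ((#>) N ` H) * card N = card H"
proof -
  interpret H: group "G\<lparr>carrier := H\<rparr>"
    using subgroup_imp_group[OF H] .
  have "rcosets\<^bsub>G\<lparr>carrier := H\<rparr>\<^esub> N = (#>) N ` H"
    by (auto simp: RCOSETS_def)
  then show ?thesis
    using H.lagrange[OF subgroup_incl[OF normal_imp_subgroup[OF N(1)] H N(2)]]
    by (simp add: order_def)
qed

text \<open>For \<open>c = [y, z]\<close> commuting with \<open>y\<close>, this is the identity \<open>[y\<^sup>k, z] = [y, z]\<^sup>k\<close>.\<close>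
lemma central_commutator_power:
  assumes "y \<in> carrier G" "z \<in> carrier G" "c \<in> carrier G"
    and swap: "y \<otimes> z = c \<otimes> z \<otimes> y" and cy: "c \<otimes> y = y \<otimes> c"
  shows "y [^] (k::nat) \<otimes> z = c [^] k \<otimes> z \<otimes> y [^] k"
proof (induction k)
  case 0
  then show ?case
    using assms by simp
next
  case (Suc k)
  have "y [^] k \<otimes> c = c \<otimes> y [^] k"
    using group_commutes_pow[of y c k] cy assms by simp
  then have "y [^] Suc k \<otimes> z = c \<otimes> (y [^] k \<otimes> z) \<otimes> y"
    using assms by (simp add: m_assoc flip: m_assoc[of _ c])
  also have "\<dots> = (c \<otimes> c [^] k) \<otimes> z \<otimes> (y [^] k \<otimes> y)"
    using Suc assms by (simp add: m_assoc)
  also have "c \<otimes> c [^] k = c [^] Suc k"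
    using assms nat_pow_Suc2 by simp
  finally show ?case
    by simp
qed

text \<open>Let \<open>e = |G/G\<^sup>2|\<close>. If \<open>e\<close> annihilates \<open>G\<^sup>i/G\<^sup>i\<^sup>+\<^sup>1\<close>, then modulo \<open>G\<^sup>i\<^sup>+\<^sup>2\<close> the central
  commutators satisfy \<open>[y, g]\<^sup>e = [y\<^sup>e, g] = 1\<close> for \<open>y \<in> G\<^sup>i\<close>, because \<open>y\<^sup>e \<in> G\<^sup>i\<^sup>+\<^sup>1\<close> is central
  there. These commutators generate the abelian group \<open>G\<^sup>i\<^sup>+\<^sup>1/G\<^sup>i\<^sup>+\<^sup>2\<close>, so \<open>e\<close> annihilates it.\<close>
lemma pow_in_lower_central_Suc:
  assumes "i \<ge> 1" "x \<in> lower_central G i"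
  shows "x [^] order (G Mod lower_central G 2) \<in> lower_central G (Suc i)"
  using assms
proof (induction i arbitrary: x rule: nat_induct_at_least)
  case base
  let ?N = "lower_central G 2"
  interpret q: group_hom G "G Mod ?N" "(#>) ?N"
    using quotient_group_hom[OF lower_central_normal] .
  have x: "x \<in> carrier G"
    using base by simp
  have "?N #> (x [^] order (G Mod ?N)) = ?N"
    using q.hom_nat_pow[OF x] q.H.pow_order_eq_1[OF q.hom_closed[OF x]] by simp
  then have "x [^] order (G Mod ?N) \<in> ?N"
    using coset_eq_one_iff[OF lower_central_normal nat_pow_closed[OF x]] by blast
  then show ?case
    by (simp add: numeral_2_eq_2 del: lower_central.simps)
next
  case (Suc i)
  define e where "e = order (G Mod lower_central G 2)"
  let ?M = "lower_central G (Suc i)" and ?N = "lower_central G (Suc (Suc i))"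
  interpret q: group_hom G "G Mod ?N" "(#>) ?N"
    using quotient_group_hom[OF lower_central_normal] .
  have M: "subgroup ?M G" and N: "subgroup ?N G"
    using normal_imp_subgroup[OF lower_central_normal] by blast+
  have central: "(?N #> c) \<otimes>\<^bsub>G Mod ?N\<^esub> (?N #> g) = (?N #> g) \<otimes>\<^bsub>G Mod ?N\<^esub> (?N #> c)"
    if "c \<in> ?M" "g \<in> carrier G" for c g
    using lower_central_central_mod[of "Suc i" c g] that by simp
  (* T is a subgroup because the e-th power is multiplicative on elements central modulo the next
     term, so only the generating commutators have to be tested. *)
  define T where "T = {c \<in> ?M. c [^] e \<in> ?N}"
  have T_iff: "c \<in> T \<longleftrightarrow> (?N #> c) [^]\<^bsub>G Mod ?N\<^esub> e = \<one>\<^bsub>G Mod ?N\<^esub>" if "c \<in> ?M" for c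
    using that coset_eq_one_iff[OF lower_central_normal, of "c [^] e" "Suc (Suc i)"]
      q.hom_nat_pow[of c e] subgroup.mem_carrier[OF M] by (simp add: T_def)
  have Mc: "\<And>c. c \<in> ?M \<Longrightarrow> c \<in> carrier G"
    using subgroup.mem_carrier[OF M] .
  have T: "subgroup T G"
  proof (rule subgroupI)
    show "T \<subseteq> carrier G"
      using Mc by (auto simp: T_def)
    show "T \<noteq> {}"
      using subgroup.one_closed[OF M] subgroup.one_closed[OF N] by (auto simp: T_def)
    show "inv a \<in> T" if "a \<in> T" for a
      using that Mc subgroup.m_inv_closed[OF M] subgroup.m_inv_closed[OF N]
      by (auto simp: T_def nat_pow_inv)
    show "a \<otimes> b \<in> T" if a: "a \<in> T" and b: "b \<in> T" for a b
    proof -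
      have ab: "a \<in> ?M" "b \<in> ?M" "a \<in> carrier G" "b \<in> carrier G"
        using a b Mc by (auto simp: T_def)
      have "(?N #> (a \<otimes> b)) [^]\<^bsub>G Mod ?N\<^esub> e =
          (?N #> a) [^]\<^bsub>G Mod ?N\<^esub> e \<otimes>\<^bsub>G Mod ?N\<^esub> (?N #> b) [^]\<^bsub>G Mod ?N\<^esub> e"
        using q.H.pow_mult_distrib[OF central[OF ab(1,4)] q.hom_closed[OF ab(3)] q.hom_closed[OF ab(4)]]
          q.hom_mult[OF ab(3,4)] by simp
      also have "\<dots> = \<one>\<^bsub>G Mod ?N\<^esub>"
        using T_iff[OF ab(1)] T_iff[OF ab(2)] a b q.H.l_one[OF q.H.one_closed] by simp
      finally show ?thesis
        using T_iff[OF subgroup.m_closed[OF M ab(1,2)]] by simp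
    qed
  qed
  have "y \<otimes> g \<otimes> inv y \<otimes> inv g \<in> T" if y: "y \<in> lower_central G i" and g: "g \<in> carrier G" for y g
  proof -
    let ?c = "y \<otimes> g \<otimes> inv y \<otimes> inv g"
    have yc: "y \<in> carrier G"
      using y normal_imp_subgroup[OF lower_central_normal] subgroup.mem_carrier by metis
    have c: "?c \<in> ?M"
      using commutator_in_lower_central[OF Suc.hyps y g] .
    let ?Y = "?N #> y" and ?Z = "?N #> g" and ?C = "?N #> ?c"
    have cl: "?Y \<in> carrier (G Mod ?N)" "?Z \<in> carrier (G Mod ?N)" "?C \<in> carrier (G Mod ?N)"
      using q.hom_closed yc g Mc[OF c] by blast+
    have "?c \<otimes> g \<otimes> y = y \<otimes> g"
      using yc g by (simp add: m_assoc)
    then have swap: "?Y \<otimes>\<^bsub>G Mod ?N\<^esub> ?Z = ?C \<otimes>\<^bsub>G Mod ?N\<^esub> ?Z \<otimes>\<^bsub>G Mod ?N\<^esub> ?Y"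
      using q.hom_mult yc g Mc[OF c] by (metis m_closed)
    have powers: "?Y [^]\<^bsub>G Mod ?N\<^esub> (k::nat) \<otimes>\<^bsub>G Mod ?N\<^esub> ?Z =
        ?C [^]\<^bsub>G Mod ?N\<^esub> k \<otimes>\<^bsub>G Mod ?N\<^esub> ?Z \<otimes>\<^bsub>G Mod ?N\<^esub> ?Y [^]\<^bsub>G Mod ?N\<^esub> k" for k
      using q.H.central_commutator_power[OF cl swap central[OF c yc]] .
    have "y [^] e \<in> ?M"
      using Suc.IH[OF y] by (simp add: e_def)
    then have "?Y [^]\<^bsub>G Mod ?N\<^esub> e \<otimes>\<^bsub>G Mod ?N\<^esub> ?Z = ?Z \<otimes>\<^bsub>G Mod ?N\<^esub> ?Y [^]\<^bsub>G Mod ?N\<^esub> e"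
      using central[of "y [^] e" g] g q.hom_nat_pow[OF yc, of e] by simp
    then have "?C [^]\<^bsub>G Mod ?N\<^esub> e \<otimes>\<^bsub>G Mod ?N\<^esub> (?Z \<otimes>\<^bsub>G Mod ?N\<^esub> ?Y [^]\<^bsub>G Mod ?N\<^esub> e)
        = ?Z \<otimes>\<^bsub>G Mod ?N\<^esub> ?Y [^]\<^bsub>G Mod ?N\<^esub> e"
      using powers[of e] cl by (metis q.H.m_assoc q.H.nat_pow_closed)
    then have "?C [^]\<^bsub>G Mod ?N\<^esub> e = \<one>\<^bsub>G Mod ?N\<^esub>"
      using cl by (meson q.H.m_closed q.H.nat_pow_closed q.H.r_cancel_one)
    then show ?thesis
      using T_iff[OF c] by simp
  qed
  then have "?M \<subseteq> T"
    using lower_central_le[OF Suc.hyps T] by blast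
  then show ?case
    using Suc.prems by (auto simp: T_def e_def)
qed

lemma cyclic_lower_central_factor:
  assumes fin: "finite (carrier G)" and i: "i \<ge> 1"
    and cyc: "cyclic_group ((G Mod lower_central G (Suc i))
      \<lparr>carrier := (#>) (lower_central G (Suc i)) ` lower_central G i\<rparr>)"
  shows "card ((#>) (lower_central G (Suc i)) ` lower_central G i) dvd order (G Mod lower_central G 2)"
proof -
  let ?N = "lower_central G (Suc i)"
  let ?A = "(#>) ?N ` lower_central G i"
  interpret q: group_hom G "G Mod ?N" "(#>) ?N"
    using quotient_group_hom[OF lower_central_normal] .
  have sub: "subgroup (lower_central G i) G"
    using normal_imp_subgroup[OF lower_central_normal] .
  obtain a where a: "a \<in> ?A" "?A = generate (G Mod ?N) {a}"
    using cyc q.H.cyclic_group_subgroup_iff[OF q.subgroup_img_is_subgroup[OF sub]]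
    by (auto simp: cyclic_subgroups_within_def)
  obtain x where "x \<in> lower_central G i" "a = ?N #> x"
    using a(1) by blast
  then have x: "x \<in> lower_central G i" "?A = generate (G Mod ?N) {?N #> x}"
    using a(2) by blast+
  then have xc: "x \<in> carrier G"
    using subgroup.mem_carrier[OF sub] by blast
  have "(?N #> x) [^]\<^bsub>G Mod ?N\<^esub> order (G Mod lower_central G 2) = \<one>\<^bsub>G Mod ?N\<^esub>"
    using pow_in_lower_central_Suc[OF i x(1)] q.hom_nat_pow[OF xc]
      coset_eq_one_iff[OF lower_central_normal, of "x [^] order (G Mod lower_central G 2)" "Suc i"] xc
    by simp
  then have "q.H.ord (?N #> x) dvd order (G Mod lower_central G 2)"
    using q.H.pow_eq_id[OF q.hom_closed[OF xc]] by blast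
  then show ?thesis
    using x(2) q.H.generate_pow_card[OF q.hom_closed[OF xc]] by simp
qed

lemma central_times_powers_commute:
  assumes "v \<in> carrier G" "w \<in> carrier G" "x \<in> carrier G"
    and v: "\<And>z. z \<in> carrier G \<Longrightarrow> v \<otimes> z = z \<otimes> v"
    and w: "\<And>z. z \<in> carrier G \<Longrightarrow> w \<otimes> z = z \<otimes> w"
  shows "(v \<otimes> x [^] (k::int)) \<otimes> (w \<otimes> x [^] (j::int)) = (w \<otimes> x [^] j) \<otimes> (v \<otimes> x [^] k)"
proof -
  have *: "(a \<otimes> x [^] i) \<otimes> (b \<otimes> x [^] i') = (a \<otimes> b) \<otimes> x [^] (i + i')"
    if "a \<in> carrier G" "b \<in> carrier G" "b \<otimes> x [^] i = x [^] i \<otimes> b" for a b and i i' :: int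
  proof -
    have "(a \<otimes> x [^] i) \<otimes> (b \<otimes> x [^] i') = a \<otimes> (x [^] i \<otimes> b) \<otimes> x [^] i'"
      using that assms(3) by (simp add: m_assoc)
    also have "\<dots> = (a \<otimes> b) \<otimes> (x [^] i \<otimes> x [^] i')"
      using that assms(3) by (simp add: m_assoc flip: that(3))
    finally show ?thesis
      using assms(3) by (simp add: int_pow_mult)
  qed
  show ?thesis
    using *[OF assms(1,2) w[OF int_pow_closed[OF assms(3)]], of k j]
      *[OF assms(2,1) v[OF int_pow_closed[OF assms(3)]], of j k]
    by (simp only: v[OF assms(2)] add.commute[of j k])
qed

text \<open>If \<open>G = \<langle>x\<rangle>G\<^sup>2\<close> and \<open>G\<^sup>2 \<subseteq> G\<^sup>i\<close>, then \<open>G/G\<^sup>i\<^sup>+\<^sup>1\<close> is generated by the image of \<open>x\<close> and central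
  elements, so it is abelian and \<open>G\<^sup>2 \<subseteq> G\<^sup>i\<^sup>+\<^sup>1\<close>. Inductively \<open>G\<^sup>2\<close> lies in all terms of the series,
  hence is trivial, and \<open>G = \<langle>x\<rangle>\<close>.\<close>
lemma cyclic_of_cyclic_abelianization:
  assumes cyc: "cyclic_group (G Mod lower_central G 2)" and nil: "lower_central G (Suc l) = {\<one>}" "l \<ge> 1"
  shows "cyclic_group G"
proof -
  let ?N = "lower_central G 2"
  interpret q2: group_hom G "G Mod ?N" "(#>) ?N"
    using quotient_group_hom[OF lower_central_normal] .
  obtain x where x: "x \<in> carrier G" and gen: "carrier (G Mod ?N) = range (\<lambda>k::int. (?N #> x) [^]\<^bsub>G Mod ?N\<^esub> k)"
    using cyc unfolding q2.H.cyclic_group by (auto simp: carrier_FactGroup)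
  have form: "\<exists>k::int. \<exists>v \<in> ?N. g = v \<otimes> x [^] k" if g: "g \<in> carrier G" for g
  proof -
    obtain k :: int where "?N #> g = (?N #> x) [^]\<^bsub>G Mod ?N\<^esub> k"
      using gen q2.hom_closed[OF g] by auto
    then have "?N #> g = ?N #> (x [^] k)"
      using q2.hom_int_pow[OF x] by simp
    moreover have "g \<in> ?N #> g"
      using rcos_self[OF g normal_imp_subgroup[OF lower_central_normal]] .
    ultimately show ?thesis
      by (auto simp: r_coset_def)
  qed
  have stable: "?N \<subseteq> lower_central G (Suc i)" if "i \<ge> 1" for i
    using that
  proof (induction i rule: nat_induct_at_least)
    case base
    then show ?case
      by (simp add: numeral_2_eq_2 del: lower_central.simps)
  next
    case (Suc i)
    let ?M = "lower_central G (Suc (Suc i))"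
    interpret q: group_hom G "G Mod ?M" "(#>) ?M"
      using quotient_group_hom[OF lower_central_normal] .
    have "g \<otimes> h \<otimes> inv g \<otimes> inv h \<in> ?M" if g: "g \<in> carrier G" and h: "h \<in> carrier G" for g h
    proof -
      obtain k :: int and v where v: "v \<in> ?N" "g = v \<otimes> x [^] k"
        using form[OF g] by blast
      obtain j :: int and w where w: "w \<in> ?N" "h = w \<otimes> x [^] j"
        using form[OF h] by blast
      have vw: "v \<in> carrier G" "w \<in> carrier G"
        using v w normal_imp_subgroup[OF lower_central_normal] subgroup.mem_carrier by metis+
      have c: "(?M #> v) \<otimes>\<^bsub>G Mod ?M\<^esub> (?M #> z) = (?M #> z) \<otimes>\<^bsub>G Mod ?M\<^esub> (?M #> v)"
        "(?M #> w) \<otimes>\<^bsub>G Mod ?M\<^esub> (?M #> z) = (?M #> z) \<otimes>\<^bsub>G Mod ?M\<^esub> (?M #> w)"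
        if "z \<in> carrier G" for z
        using lower_central_central_mod[of "Suc i" _ z] Suc.IH v w that by auto
      have "(?M #> g) \<otimes>\<^bsub>G Mod ?M\<^esub> (?M #> h) = (?M #> h) \<otimes>\<^bsub>G Mod ?M\<^esub> (?M #> g)"
      proof -
        have "?M #> g = (?M #> v) \<otimes>\<^bsub>G Mod ?M\<^esub> (?M #> x) [^]\<^bsub>G Mod ?M\<^esub> k"
          "?M #> h = (?M #> w) \<otimes>\<^bsub>G Mod ?M\<^esub> (?M #> x) [^]\<^bsub>G Mod ?M\<^esub> j"
          using v w vw x q.hom_mult q.hom_int_pow by auto
        moreover have "(?M #> v) \<otimes>\<^bsub>G Mod ?M\<^esub> z = z \<otimes>\<^bsub>G Mod ?M\<^esub> (?M #> v)"
          "(?M #> w) \<otimes>\<^bsub>G Mod ?M\<^esub> z = z \<otimes>\<^bsub>G Mod ?M\<^esub> (?M #> w)"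
          if "z \<in> carrier (G Mod ?M)" for z
          using c that by (auto simp: carrier_FactGroup)
        ultimately show ?thesis
          using q.H.central_times_powers_commute[OF q.hom_closed[OF vw(1)] q.hom_closed[OF vw(2)]
              q.hom_closed[OF x]] by simp
      qed
      then show ?thesis
        using commute_in_quotient_iff[OF lower_central_normal g h] by blast
    qed
    then have "lower_central G (Suc 1) \<subseteq> ?M"
      using lower_central_le[OF le_refl normal_imp_subgroup[OF lower_central_normal], of "Suc (Suc i)"]
      by (simp del: lower_central.simps(3))
    then show ?case
      by (simp add: numeral_2_eq_2 del: lower_central.simps)
  qed
  have "carrier G = range (\<lambda>k::int. x [^] k)"
  proof (intro equalityI subsetI)
    fix g assume "g \<in> carrier G"
    then obtain k :: int and v where "v \<in> ?N" "g = v \<otimes> x [^] k"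
      using form by blast
    then show "g \<in> range (\<lambda>k::int. x [^] k)"
      using stable[OF nil(2)] nil(1) x by auto
  qed (use x in auto)
  then show ?thesis
    using x cyclic_group by blast
qed

end

section \<open>The lower bound\<close>

lemma (in finite_p_group) eta_ge_central_section:
  assumes N: "N \<lhd> G" "N \<subseteq> H" and H: "subgroup H G"
    and central: "\<And>x g. x \<in> H \<Longrightarrow> g \<in> carrier G \<Longrightarrow> x \<otimes> g \<otimes> inv x \<otimes> inv g \<in> N"
    and nc: "\<not> cyclic_group ((G Mod N)\<lparr>carrier := (#>) N ` H\<rparr>)"
    and m: "card ((#>) N ` H) = p ^ m"
  shows "2 + (p - 1) * (m - 1) \<le> eta G"
proof -
  interpret q: group_hom G "G Mod N" "(#>) N"
    using quotient_group_hom[OF N(1)] .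
  define A where "A = (#>) N ` H"
  have A: "subgroup A (G Mod N)"
    using q.subgroup_img_is_subgroup[OF H] by (simp add: A_def)
  have Hc: "\<And>x. x \<in> H \<Longrightarrow> x \<in> carrier G"
    using subgroup.mem_carrier[OF H] .
  have A_central: "a \<otimes>\<^bsub>G Mod N\<^esub> (N #> g) = (N #> g) \<otimes>\<^bsub>G Mod N\<^esub> a"
    if a: "a \<in> A" and g: "g \<in> carrier G" for a g
  proof -
    obtain x where x: "x \<in> H" "a = N #> x"
      using a by (auto simp: A_def)
    show ?thesis
      unfolding x(2) commute_in_quotient_iff[OF N(1) Hc[OF x(1)] g] using central[OF x(1) g] .
  qed
  interpret A: group "(G Mod N)\<lparr>carrier := A\<rparr>"
    using q.H.subgroup_imp_group[OF A] .
  have "comm_group ((G Mod N)\<lparr>carrier := A\<rparr>)"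
    using A_central Hc by (intro A.group_comm_groupI) (auto simp: A_def)
  then interpret A: comm_group "(G Mod N)\<lparr>carrier := A\<rparr>" .
  interpret A: finite_abelian_p_group "(G Mod N)\<lparr>carrier := A\<rparr>" p m
    using prime_p m by unfold_locales (auto simp: order_def A_def)
  have "generate ((G Mod N)\<lparr>carrier := A\<rparr>) {a} = generate (G Mod N) {a}" if "a \<in> A" for a
    using q.H.generate_consistent[of "{a}" A] that A by simp
  then have "max_cyclics ((G Mod N)\<lparr>carrier := A\<rparr>) A = max_cyclics (G Mod N) A"
    unfolding max_cyclics_def cyclic_subgroups_within_def by (simp cong: image_cong)
  then have "2 + (p - 1) * (m - 1) \<le> card (max_cyclics (G Mod N) A)"
    using A.noncyclic_card_max_cyclics_ge nc by (simp add: A_def)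
  also have "\<dots> \<le> eta G"
    using A_central Hc finite_carrier A
    by (intro q.card_max_cyclics_le_eta) (auto simp: carrier_FactGroup A_def)
  finally show ?thesis .
qed

text \<open>Logarithms \<open>a i\<close> of the orders of the terms telescope from \<open>n\<close> down to \<open>0\<close>, so some difference
  \<open>m = a i - a (i + 1)\<close> is at least \<open>n/l\<close>. The bound comes from the \<open>i\<close>-th factor if it is noncyclic
  and from the abelianization otherwise.\<close>
theorem theorem1p1:
  fixes G :: "('a, 'b) monoid_scheme" and p n l :: nat
  assumes "Factorial_Ring.prime p"
    and "group G" and "finite (carrier G)"
    and "Coset.order G = p ^ n"
    and "\<not> cyclic_group G"
    and "l \<ge> 1" and "has_nilpotence_class G l"
  shows "real (eta G) \<ge> (real p - 1) * (real n / real l - 2) + real p + 1"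
proof -
  interpret finite_p_group G p n
    using assms by (simp add: finite_p_group_def finite_p_group_axioms_def)
  define L where "L = lower_central G"
  define A where "A i = (#>\<^bsub>G\<^esub>) (L (Suc i)) ` L i" for i
  have L_normal: "L i \<lhd> G" and L_sub: "subgroup (L i) G" for i
    using lower_central_normal normal_imp_subgroup by (auto simp: L_def)
  have L_dec: "L (Suc i) \<subseteq> L i" if "i \<ge> 1" for i
    using lower_central_decreasing[OF that] by (simp add: L_def)
  have L1: "L 1 = carrier G" and L_last: "L (Suc l) = {\<one>\<^bsub>G\<^esub>}"
    using assms(7) by (auto simp: L_def has_nilpotence_class_def)
  have p1: "p > 1"
    using prime_gt_1_nat[OF prime_p] .
  have "\<exists>a. card (L i) = p ^ a" for i
    using lagrange[OF L_sub, of i] order_eq divides_primepow_nat[OF prime_p]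
    by (metis dvd_triv_right)
  then obtain a where a: "\<And>i. card (L i) = p ^ a i"
    by metis
  have a1: "a 1 = n"
    using a[of 1] L1 order_eq p1 by (simp add: order_def)
  have a_last: "a (Suc l) = 0"
  proof -
    have "p ^ a (Suc l) = p ^ 0"
      using a[of "Suc l"] L_last by simp
    then show ?thesis
      using p1 power_inject_exp by blast
  qed
  have a_dec: "a (Suc i) \<le> a i" if "i \<ge> 1" for i
  proof -
    have "card (L (Suc i)) \<le> card (L i)"
      using L_dec[OF that] card_mono finite_subset[OF subgroup.subset[OF L_sub] finite_carrier] by blast
    then show ?thesis
      using a p1 by simp
  qed
  have cardA: "card (A i) = p ^ (a i - a (Suc i))" if i: "i \<ge> 1" for i
  proof -
    have "card (A i) * p ^ a (Suc i) = p ^ (a i - a (Suc i)) * p ^ a (Suc i)"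
      using card_quotient_image[OF L_normal L_dec[OF i] L_sub] a a_dec[OF i]
      by (simp add: A_def flip: power_add)
    then show ?thesis
      using p1 by simp
  qed
  have "int (\<Sum>i = 1..l. a i - a (Suc i)) = (\<Sum>i = 1..l. int (a i) - int (a (Suc i)))"
    unfolding of_nat_sum by (rule sum.cong) (auto simp: of_nat_diff a_dec)
  also have "\<dots> = int n"
    using sum_Suc_diff'[of 1 "Suc l" "\<lambda>i. - int (a i)"] assms(6) a1 a_last
    by (simp add: atLeastLessThanSuc_atLeastAtMost)
  finally have total: "(\<Sum>i = 1..l. a i - a (Suc i)) = n"
    by (simp only: of_nat_eq_iff)
  have "\<exists>i \<ge> 1. n \<le> l * (a i - a (Suc i))"
  proof (rule ccontr)
    assume "\<not> ?thesis"
    then have "\<And>i. i \<in> {1..l} \<Longrightarrow> l * (a i - a (Suc i)) < n"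
      by (meson atLeastAtMost_iff not_le)
    then have "(\<Sum>i = 1..l. l * (a i - a (Suc i))) < (\<Sum>i = 1..l. n)"
      using assms(6) by (intro sum_strict_mono) auto
    then show False
      using total by (simp flip: sum_distrib_left)
  qed
  then obtain i where i: "i \<ge> 1" "n \<le> l * (a i - a (Suc i))"
    by blast
  define m where "m = a i - a (Suc i)"
  have mono: "(real p - 1) * (real n / real l - 2) + real p + 1 \<le> real (2 + (p - 1) * (k - 1))"
    if "m \<le> k" for k
  proof -
    have "real n \<le> real l * real m"
      using i(2) by (simp add: m_def flip: of_nat_mult)
    then have "real n / real l \<le> real m"
      using assms(6) by (simp add: divide_le_eq mult.commute)
    then have "real n / real l - 1 \<le> real (k - 1)"
      using that by linarith
    then have "(real p - 1) * (real n / real l - 1) \<le> (real p - 1) * real (k - 1)"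
      using p1 by (intro mult_left_mono) auto
    moreover have "(real p - 1) * (real n / real l - 2) + real p + 1 =
        2 + (real p - 1) * (real n / real l - 1)"
      by (simp add: algebra_simps)
    moreover have "real (2 + (p - 1) * (k - 1)) = 2 + (real p - 1) * real (k - 1)"
      using p1 by (simp add: of_nat_diff)
    ultimately show ?thesis
      by linarith
  qed
  have comm: "x \<otimes>\<^bsub>G\<^esub> g \<otimes>\<^bsub>G\<^esub> inv\<^bsub>G\<^esub> x \<otimes>\<^bsub>G\<^esub> inv\<^bsub>G\<^esub> g \<in> L (Suc j)"
    if "j \<ge> 1" "x \<in> L j" "g \<in> carrier G" for j x g
    using commutator_in_lower_central that by (simp add: L_def)
  have section_bound: "2 + (p - 1) * (a j - a (Suc j) - 1) \<le> eta G"
    if j: "j \<ge> 1" "\<not> cyclic_group ((G Mod L (Suc j))\<lparr>carrier := A j\<rparr>)" for j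
    using eta_ge_central_section[OF L_normal L_dec[OF j(1)] L_sub comm[OF j(1)]
        j(2)[unfolded A_def] cardA[OF j(1), unfolded A_def]] .
  show ?thesis
  proof (cases "cyclic_group ((G Mod L (Suc i))\<lparr>carrier := A i\<rparr>)")
    case False
    then show ?thesis
      using section_bound[OF i(1)] mono[of m] unfolding m_def by linarith
  next
    case True
    have A1: "A 1 = carrier (G Mod L 2)"
      unfolding A_def L1 carrier_FactGroup by (simp add: numeral_2_eq_2)
    have "p ^ m dvd order (G Mod L 2)"
      using cyclic_lower_central_factor[OF finite_carrier i(1)] True cardA[OF i(1)]
      by (simp add: A_def L_def m_def)
    also have "order (G Mod L 2) = p ^ (a 1 - a 2)"
      using cardA[of 1] A1 by (simp add: order_def numeral_2_eq_2)
    finally have "m \<le> a 1 - a 2"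
      using p1 by (simp add: power_dvd_imp_le)
    moreover have "\<not> cyclic_group (G Mod L 2)"
      using cyclic_of_cyclic_abelianization[OF _ _ assms(6)] L_last assms(5) by (auto simp: L_def)
    then have "\<not> cyclic_group ((G Mod L (Suc 1))\<lparr>carrier := A 1\<rparr>)"
      using A1 by (simp add: numeral_2_eq_2)
    then have "2 + (p - 1) * (a 1 - a 2 - 1) \<le> eta G"
      using section_bound[of 1] by (simp add: numeral_2_eq_2)
    ultimately show ?thesis
      using mono[of "a 1 - a 2"] by linarith
  qed
qed

end
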